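(* For every positive integer $k$ there exists a finite family of polygonal $2$-chains in the plane whose disjointness graph is triangle-free and has chromatic number at least $k$.
   Context: A polygonal $k$-chain is a continuous curve in the plane consisting of $k$ straight-line segments $s_1,\dots,s_k$, where consecutive segments $s_i,s_{i+1}$ share an endpoint. The disjointness graph of a finite family of subsets of the plane is the graph whose vertices are the members of the family, two being adjacent if and only if they are disjoint. *)

theory Defs
  imports "HOL-Analysis.Analysis"
begin

definition polygonal_2chain :: "(real^2) set \<Rightarrow> bool" where
  "polygonal_2chain S \<longleftrightarrow>
     (\<exists>a b c. a \<noteq> b \<and> b \<noteq> c \<and> S = closed_segment a b \<union> closed_segment b c)"

definition disj_adj :: "'a set set \<Rightarrow> 'a set \<Rightarrow> 'a set \<Rightarrow> bool" where
  "disj_adj F A B \<longleftrightarrow> A \<in> F \<and> B \<in> F \<and> A \<noteq> B \<and> A \<inter> B = {}"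

definition triangle_free :: "'v set \<Rightarrow> ('v \<Rightarrow> 'v \<Rightarrow> bool) \<Rightarrow> bool" where
  "triangle_free V E \<longleftrightarrow>
     \<not> (\<exists>x\<in>V. \<exists>y\<in>V. \<exists>z\<in>V. E x y \<and> E y z \<and> E x z)"

definition proper_colouring :: "'v set \<Rightarrow> ('v \<Rightarrow> 'v \<Rightarrow> bool) \<Rightarrow> ('v \<Rightarrow> nat) \<Rightarrow> nat \<Rightarrow> bool" where
  "proper_colouring V E c n \<longleftrightarrow>
     (\<forall>v\<in>V. c v < n) \<and> (\<forall>u\<in>V. \<forall>v\<in>V. E u v \<longrightarrow> c u \<noteq> c v)"

definition chromatic_number :: "'v set \<Rightarrow> ('v \<Rightarrow> 'v \<Rightarrow> bool) \<Rightarrow> nat" where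
  "chromatic_number V E = (LEAST n. \<exists>c. proper_colouring V E c n)"

end

theory Submission
  imports Defs
begin

text \<open>
  The complete shift graph on the pairs \<open>i < j \<le> N\<close>, in which \<open>(i, j)\<close> is adjacent to
  \<open>(j, k)\<close>, is triangle-free, and its chromatic number is at least the binary logarithm of \<open>N\<close>. It is
  realised exactly as a disjointness graph. Fix rapidly decreasing scales
  \<open>h 0 \<gg> r 0 \<gg> h 1 \<gg> r 1 \<gg> \<dots>\<close>. The chain of \<open>(i, j)\<close> is a thin
  spike: its upper leg starts at \<open>(-1, -i)\<close>, has slope about \<open>i\<close>, passes
  through \<open>(0, h j)\<close> and stops at the abscissa \<open>r i\<close>, from where the lower leg returns to a
  point \<open>e j\<close> just left of the origin, on the line of slope \<open>j + 1/2\<close> through it.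
  The spike of \<open>(j, k)\<close> enters that of \<open>(i, j)\<close> right above \<open>e j\<close> and stays inside.
  Two spikes \<open>(i, j)\<close>, \<open>(k, l)\<close> with \<open>j < k\<close> cross because the upper leg of
  \<open>(k, l)\<close>, being steeper, passes below \<open>e j\<close>. Overlapping pairs have crossing
  upper legs, and pairs with a common first or second entry share an end point.
\<close>

section \<open>Shift graphs\<close>

text \<open>The colour of \<open>(i, j)\<close> belongs to the set of colours used on pairs starting
  at \<open>i\<close>, but not to that for \<open>j\<close>. So \<open>N + 1\<close> indices get
  distinct subsets of the \<open>n\<close> colours.\<close>

lemma shift_colouring_bound:
  fixes c :: "nat \<Rightarrow> nat \<Rightarrow> nat"
  assumes bound: "\<And>i j. i < j \<Longrightarrow> j \<le> N \<Longrightarrow> c i j < n"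
    and proper: "\<And>i j k. i < j \<Longrightarrow> j < k \<Longrightarrow> k \<le> N \<Longrightarrow> c i j \<noteq> c j k"
  shows "N < 2 ^ n"
proof -
  define S where "S i = c i ` {i<..N}" for i
  have neq: "S i \<noteq> S j" if "i < j" "j \<le> N" for i j
  proof -
    have "c i j \<in> S i" using that by (auto simp: S_def)
    moreover have "c i j \<notin> S j" using that proper[of i j] by (fastforce simp: S_def)
    ultimately show ?thesis by blast
  qed
  have "inj_on S {..N}"
    by (rule inj_onI) (metis atMost_iff linorder_neqE_nat neq)
  moreover have "S ` {..N} \<subseteq> Pow {..<n}"
    using bound by (auto simp: S_def)
  ultimately have "card {..N} \<le> card (Pow {..<n})"
    by (metis card_inj_on_le finite_Pow_iff finite_lessThan)
  then show ?thesis by (simp add: card_Pow)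
qed

text \<open>The \<open>LEAST\<close> is attained once some colouring exists; an injective numbering
  of \<open>F\<close> is one.\<close>

lemma ex_proper_colouring_chromatic_number:
  assumes "finite F"
  shows "\<exists>c. proper_colouring F (disj_adj F) c (chromatic_number F (disj_adj F))"
proof -
  obtain f :: "'a set \<Rightarrow> nat" and n where f: "f ` F = {i. i < n}" "inj_on f F"
    using finite_imp_inj_to_nat_seg[OF assms] by blast
  have "proper_colouring F (disj_adj F) f n"
    using f by (auto simp: proper_colouring_def disj_adj_def inj_on_def)
  then show ?thesis
    unfolding chromatic_number_def by (intro LeastI[of "\<lambda>n. \<exists>c. proper_colouring F (disj_adj F) c n"]) blast
qed

section \<open>Segments as graphs of affine functions\<close>

definition pt :: "real \<Rightarrow> real \<Rightarrow> real^2" where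
  "pt x y = vector [x, y]"

lemma pt_eq_iff [simp]: "pt x y = pt x' y' \<longleftrightarrow> x = x' \<and> y = y'"
  by (metis pt_def vector_2)

lemma pt_combination: "(1 - t) *\<^sub>R pt a b + t *\<^sub>R pt c d = pt ((1 - t) * a + t * c) ((1 - t) * b + t * d)"
  by (simp add: pt_def vec_eq_iff forall_2)

lemma closed_segment_graph:
  assumes "a < b"
  shows "closed_segment (pt a (q + m * a)) (pt b (q + m * b)) = (\<lambda>x. pt x (q + m * x)) ` {a..b}"
proof -
  have ivl: "{a..b} = (\<lambda>t. (1 - t) * a + t * b) ` {0..1}"
    using closed_segment_eq_real_ivl[of a b] assms
    by (auto simp: closed_segment_image_interval)
  have "(1 - t) * (q + m * a) + t * (q + m * b) = q + m * ((1 - t) * a + t * b)" for t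
    by (simp add: algebra_simps)
  then show ?thesis
    unfolding closed_segment_image_interval pt_combination ivl image_image by simp
qed

lemma graphs_disjoint:
  assumes "\<And>x. x \<in> A \<Longrightarrow> x \<in> B \<Longrightarrow> f x \<noteq> g x"
  shows "(\<lambda>x. pt x (f x)) ` A \<inter> (\<lambda>x. pt x (g x)) ` B = {}"
  using assms by auto

lemma affine_crossing:
  fixes a b :: real
  assumes "a \<le> b" "q + m * a \<le> q' + m' * a" "q' + m' * b \<le> q + m * b"
  shows "\<exists>x\<in>{a..b}. q + m * x = q' + m' * x"
proof -
  have "\<exists>x\<ge>a. x \<le> b \<and> (q + m * x) - (q' + m' * x) = 0"
    by (rule IVT') (use assms in \<open>auto intro!: continuous_intros\<close>)
  then show ?thesis by force
qed

lemma affine_less: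
  fixes a b :: real
  assumes "a \<le> x" "x \<le> b" "q + m * a < q' + m' * a" "q + m * b < q' + m' * b"
  shows "q + m * x < q' + m' * x"
proof (rule ccontr)
  assume neg: "\<not> ?thesis"
  have "0 < (m - m') * (x - a)" "0 < (m' - m) * (b - x)"
    using neg assms by (simp_all add: algebra_simps)
  then show False
    using assms(1,2) by (simp add: zero_less_mult_iff)
qed

section \<open>The spikes\<close>

text \<open>The factor \<open>real N + 1\<close> in \<open>r_le_h\<close> lets \<open>h j\<close>
  absorb differences of slopes over a width \<open>r j\<close>.\<close>

locale scales =
  fixes N :: nat and h r :: "nat \<Rightarrow> real"
  assumes r_pos: "0 < r j"
    and h_le: "h j \<le> 1 / 2"
    and r_le_h: "4 * (real N + 1) * r j \<le> h j"
    and h_le_r: "i < j \<Longrightarrow> 8 * h j \<le> r i"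
begin

definition slopeU :: "nat \<Rightarrow> nat \<Rightarrow> real" where
  "slopeU i j = real i + h j"

abbreviation U :: "nat \<Rightarrow> nat \<Rightarrow> real \<Rightarrow> real" where
  "U i j x \<equiv> h j + slopeU i j * x"

text \<open>Slope of the line from \<open>e j\<close>, at abscissa \<open>- r j\<close>, to the tip
  at \<open>r i\<close>. The \<open>1 / 2\<close> puts \<open>e j\<close> below upper legs of slope
  about \<open>j\<close> and above those of slope at least \<open>j + 1\<close>.\<close>

definition slopeL :: "nat \<Rightarrow> nat \<Rightarrow> real" where
  "slopeL i j = (U i j (r i) + (real j + 1 / 2) * r j) / (r i + r j)"

abbreviation L :: "nat \<Rightarrow> nat \<Rightarrow> real \<Rightarrow> real" where
  "L i j x \<equiv> (slopeL i j - (real j + 1 / 2)) * r j + slopeL i j * x"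

definition spike :: "nat \<Rightarrow> nat \<Rightarrow> (real^2) set" where
  "spike i j = (\<lambda>x. pt x (U i j x)) ` {-1..r i} \<union> (\<lambda>x. pt x (L i j x)) ` {- r j..r i}"

lemma h_pos: "0 < h j"
  using r_le_h[of j] r_pos[of j] by (smt (verit) mult_pos_pos of_nat_0_le_iff)

lemma r_le_h': "4 * r j \<le> h j" "c \<le> real N + 1 \<Longrightarrow> 4 * (c * r j) \<le> h j"
proof -
  show *: "4 * (c * r j) \<le> h j" if "c \<le> real N + 1" for c
    using r_le_h[of j] mult_right_mono[OF that, of "r j"] r_pos[of j] by linarith
  show "4 * r j \<le> h j" using *[of 1] by simp
qed

lemma r_lt_1: "r j < 1"
  using r_le_h'(1)[of j] h_le[of j] r_pos[of j] by simp

lemma L_apex: "L i j (r i) = U i j (r i)"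
proof -
  have "slopeL i j * (r i + r j) = U i j (r i) + (real j + 1 / 2) * r j"
    using r_pos[of i] r_pos[of j] by (simp add: slopeL_def)
  then show ?thesis by (simp add: algebra_simps)
qed

lemma L_start: "L i j (- r j) = - (real j + 1 / 2) * r j"
  by (simp add: algebra_simps)

lemma spike_2chain: "polygonal_2chain (spike i j)"
  unfolding polygonal_2chain_def
proof (intro exI conjI)
  have *: "- r j < r i" "-1 < r i"
    using r_pos[of i] r_pos[of j] by auto
  show "spike i j = closed_segment (pt (-1) (U i j (-1))) (pt (r i) (U i j (r i))) \<union>
      closed_segment (pt (r i) (U i j (r i))) (pt (- r j) (L i j (- r j)))"
    using closed_segment_graph[OF *(1), of "(slopeL i j - (real j + 1 / 2)) * r j" "slopeL i j"]
      closed_segment_graph[OF *(2), of "h j" "slopeU i j"]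
    by (simp add: spike_def L_apex closed_segment_commute)
qed (use r_pos[of i] r_pos[of j] in auto)

text \<open>Since \<open>h j\<close> and \<open>r j\<close> are negligible against
  \<open>r i\<close>, the lower leg has slope about \<open>i\<close>; the spare \<open>1 / 2\<close>
  covers the error.\<close>

lemma slopeL_le:
  assumes "i < j" "j \<le> N"
  shows "slopeL i j \<le> real i + 1 / 2"
proof -
  have "h j * r i \<le> h j"
    using h_pos[of j] r_lt_1[of i] by (simp add: mult_le_cancel_left1)
  moreover have "4 * ((real j - real i) * r j) \<le> h j"
    using assms by (intro r_le_h') auto
  ultimately have "h j + h j * r i + (real j - real i) * r j \<le> r i / 2"
    using h_le_r[OF assms(1)] h_pos[of j] by linarith
  moreover have "(real i + 1 / 2) * (r i + r j) - (U i j (r i) + (real j + 1 / 2) * r j) =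
      r i / 2 - (h j + h j * r i + (real j - real i) * r j)"
    by (simp add: slopeU_def algebra_simps add_divide_distrib)
  ultimately have "U i j (r i) + (real j + 1 / 2) * r j \<le> (real i + 1 / 2) * (r i + r j)"
    by linarith
  then show ?thesis
    using r_pos[of i] r_pos[of j] by (simp add: slopeL_def divide_le_eq)
qed

section \<open>Pairs whose spikes meet\<close>

lemma spikes_meet_same_left: "spike i j \<inter> spike i l \<noteq> {}"
proof -
  have "pt (-1) (- real i) \<in> spike i m" for m
    unfolding spike_def by (intro UnI1 image_eqI[of _ _ "-1"]) (use r_pos[of i] in \<open>auto simp: slopeU_def\<close>)
  then show ?thesis by blast
qed

lemma spikes_meet_same_right: "spike i j \<inter> spike k j \<noteq> {}"
proof -
  have "pt (- r j) (- (real j + 1 / 2) * r j) \<in> spike m j" for m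
    using r_pos[of j] r_pos[of m] L_start[of m j] by (force simp: spike_def)
  then show ?thesis by blast
qed

lemma spikes_meet_separated:
  assumes "i < j" "j < k" "k < l" "l \<le> N"
  shows "spike i j \<inter> spike k l \<noteq> {}"
proof -
  have s: "slopeL i j < real j + 1 / 2"
    using slopeL_le[of i j] assms by simp
  have "0 \<le> (real k - real j - 1) * r j"
    using assms r_pos[of j] by (intro mult_nonneg_nonneg) auto
  moreover have "0 < h l * r j"
    using h_pos r_pos by (intro mult_pos_pos)
  moreover have "L i j (- r j) - U k l (- r j) =
      (real k - real j - 1) * r j + r j / 2 + h l * r j - h l"
    by (simp add: slopeU_def algebra_simps)
  moreover have "8 * h l \<le> r j"
    using h_le_r assms by simp
  ultimately have start: "U k l (- r j) \<le> L i j (- r j)"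
    using h_pos[of l] by linarith
  \<comment> \<open>The order reverses at abscissa 0: flatter than the line from \<open>e j\<close>
    to the origin, \<open>L i j\<close> passes below the origin, and \<open>U k l\<close> above
    it.\<close>
  have "(real j + 1 / 2 - slopeL i j) * r j > 0"
    using s r_pos[of j] by auto
  then have "L i j 0 \<le> U k l 0"
    using h_pos[of l] by (simp add: algebra_simps)
  then obtain x where x: "x \<in> {- r j..0}" "U k l x = L i j x"
    using affine_crossing[OF _ start, of 0] r_pos[of j] by auto
  have "pt x (U k l x) \<in> spike k l"
    using x r_lt_1[of j] r_pos[of k] unfolding spike_def by (intro UnI1 imageI) auto
  moreover have "pt x (U k l x) \<in> spike i j"
    using x r_pos[of i] unfolding spike_def x(2) by (intro UnI2 imageI) auto
  ultimately show ?thesis by blast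
qed

lemma spikes_meet_if_U_meet:
  assumes "U i j x = U k l x" "-1 \<le> x" "x \<le> r i" "x \<le> r k"
  shows "spike i j \<inter> spike k l \<noteq> {}"
proof -
  have "pt x (U i j x) \<in> spike i j"
    using assms unfolding spike_def by (intro UnI1 imageI) auto
  moreover have "pt x (U i j x) \<in> spike k l"
    using assms unfolding spike_def assms(1) by (intro UnI1 imageI) auto
  ultimately show ?thesis by blast
qed

lemma h_antimono: "i < j \<Longrightarrow> h j < h i"
  using h_le_r[of i j] r_le_h'(1)[of i] h_pos[of i] h_pos[of j] by simp

lemma r_antimono: "i < j \<Longrightarrow> r j < r i"
  using h_le_r[of i j] r_le_h'(1)[of j] r_pos[of j] r_pos[of i] by simp

text \<open>At 0 the leg \<open>U k l\<close> is lower because \<open>h l < h j\<close>; by abscissa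
  \<open>r k\<close> its greater slope has gained about \<open>r k\<close> or more, which outweighs
  \<open>h j\<close>.\<close>

lemma spikes_meet_interleaved:
  assumes "i < k" "k < j" "j < l"
  shows "spike i j \<inter> spike k l \<noteq> {}"
proof -
  have "0 \<le> (real k - real i - 1) * r k"
    using assms r_pos[of k] by (intro mult_nonneg_nonneg) auto
  moreover have "0 < h l * r k"
    using h_pos r_pos by (intro mult_pos_pos)
  moreover have "h j * r k \<le> h j"
    using h_pos[of j] r_lt_1[of k] by (simp add: mult_le_cancel_left1)
  moreover have "U k l (r k) - U i j (r k) =
      (real k - real i - 1) * r k + r k + h l * r k - h j * r k + h l - h j"
    by (simp add: slopeU_def algebra_simps)
  ultimately have "U i j (r k) \<le> U k l (r k)"
    using h_le_r[OF assms(2)] h_pos[of j] h_pos[of l] by linarith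
  moreover have "U k l 0 \<le> U i j 0"
    using h_antimono[OF assms(3)] by simp
  ultimately obtain x where "x \<in> {0..r k}" "U k l x = U i j x"
    using affine_crossing[of 0 "r k"] r_pos[of k] by force
  then show ?thesis
    using r_antimono[OF assms(1)] by (intro spikes_meet_if_U_meet[of _ _ x]) auto
qed

text \<open>The upper legs cross left of the vertical axis: their heights at -1 are
  \<open>- i\<close> and \<open>- k\<close>, and at 0 they are in the opposite order.\<close>

lemma spikes_meet_nested:
  assumes "i < k" "l < j"
  shows "spike i j \<inter> spike k l \<noteq> {}"
proof -
  have "U k l (-1) \<le> U i j (-1)" "U i j 0 \<le> U k l 0"
    using assms h_antimono[OF assms(2)] by (simp_all add: slopeU_def)
  then obtain x where "x \<in> {-1..0}" "U k l x = U i j x"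
    using affine_crossing[of "-1" 0] by force
  then show ?thesis
    using r_pos[of i] r_pos[of k] by (intro spikes_meet_if_U_meet[of _ _ x]) auto
qed

text \<open>On the common abscissae both legs of \<open>(j, k)\<close> run strictly between
  \<open>L i j\<close> and \<open>U i j\<close>. Each of the four comparisons is checked at the two
  ends of its interval.\<close>

lemma spikes_disjoint_consecutive:
  assumes "i < j" "j < k" "k \<le> N"
  shows "spike i j \<inter> spike j k = {}"
proof -
  note pos = r_pos[of i] r_pos[of j] r_pos[of k] h_pos[of j] h_pos[of k]
  have s: "slopeL i j \<le> real j - 1 / 2"
    using slopeL_le[of i j] assms by simp
  have UU: "U j k x < U i j x" if "-1 \<le> x" "x \<le> r j" for x
  proof (rule affine_less[OF that])
    show "U j k (-1) < U i j (-1)"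
      using assms by (simp add: slopeU_def)
    have "4 * ((real j - real i + h k) * r j) \<le> h j"
      using assms h_le[of k] by (intro r_le_h') auto
    moreover have "h j * r j > 0" using pos by simp
    moreover have "8 * h k \<le> r j" "4 * r j \<le> h j"
      using h_le_r[OF assms(2)] r_le_h'(1) by auto
    moreover have "U i j (r j) - U j k (r j) = h j + h j * r j - h k - (real j - real i + h k) * r j"
      by (simp add: slopeU_def algebra_simps)
    ultimately show "U j k (r j) < U i j (r j)"
      using pos by linarith
  qed
  have LU: "L j k x < U i j x" if "- r k \<le> x" "x \<le> r j" for x
  proof (rule affine_less[OF that])
    have "0 < (real k + 1 / 2 - real i - h j) * r k"
      using assms h_le[of j] pos(3) by (intro mult_pos_pos) linarith+
    moreover have "U i j (- r k) - L j k (- r k) = h j + (real k + 1 / 2 - real i - h j) * r k"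
      by (simp add: slopeU_def algebra_simps)
    ultimately show "L j k (- r k) < U i j (- r k)"
      using pos(4) by linarith
    show "L j k (r j) < U i j (r j)"
      unfolding L_apex using UU[of "r j"] pos(2) by simp
  qed
  \<comment> \<open>Rising from \<open>e j\<close> with slope at most \<open>j - 1 / 2\<close>,
    \<open>L i j\<close> reaches at most \<open>(j - 3 / 2) * r j\<close>, whereas
    \<open>U j k\<close> exceeds \<open>j * r j\<close>.\<close>
  have apex: "L i j (r j) < U j k (r j)"
  proof -
    have "0 \<le> (real j - 1 / 2 - slopeL i j) * r j"
      using s pos(2) by (intro mult_nonneg_nonneg) linarith+
    moreover have "0 < h k * r j"
      using pos by (intro mult_pos_pos)
    moreover have "U j k (r j) - L i j (r j) =
        h k + h k * r j + 2 * ((real j - 1 / 2 - slopeL i j) * r j) + 3 / 2 * r j"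
      by (simp add: slopeU_def algebra_simps)
    ultimately show ?thesis using pos by linarith
  qed
  have UL: "L i j x < U j k x" if "- r j \<le> x" "x \<le> r j" for x
  proof (rule affine_less[OF that _ apex])
    have "0 \<le> (1 / 2 - h k) * r j"
      using h_le[of k] pos(2) by (intro mult_nonneg_nonneg) linarith+
    moreover have "U j k (- r j) - L i j (- r j) = h k + (1 / 2 - h k) * r j"
      by (simp add: slopeU_def algebra_simps)
    ultimately show "L i j (- r j) < U j k (- r j)"
      using pos by linarith
  qed
  have LL: "L i j x < L j k x" if "- r k \<le> x" "x \<le> r j" for x
  proof (rule affine_less[OF that])
    \<comment> \<open>At abscissa 0 the leg \<open>L i j\<close> is already \<open>r j\<close> or
      more below the origin, while \<open>e k\<close> is only of order \<open>N * r k\<close> away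
      from it.\<close>
    have "0 \<le> (real j - 1 / 2 - slopeL i j) * (r j - r k)"
      using s r_antimono[OF assms(2)] by (intro mult_nonneg_nonneg) linarith+
    moreover have "4 * ((real k - real j + 1) * r k) \<le> h k"
      using assms by (intro r_le_h') auto
    moreover have "8 * h k \<le> r j"
      using h_le_r[OF assms(2)] .
    moreover have "L j k (- r k) - L i j (- r k) =
        (real j - 1 / 2 - slopeL i j) * (r j - r k) + r j - (real k - real j + 1) * r k"
      by (simp add: algebra_simps diff_divide_distrib)
    ultimately show "L i j (- r k) < L j k (- r k)"
      using pos by linarith
    show "L i j (r j) < L j k (r j)"
      unfolding L_apex by (rule apex)
  qed
  show ?thesis
    unfolding spike_def Int_Un_distrib Int_Un_distrib2 Un_empty
  proof (intro conjI graphs_disjoint)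
    fix x
    show "U i j x \<noteq> U j k x" if "x \<in> {-1..r i}" "x \<in> {-1..r j}"
      using UU[of x] that by simp
    show "U i j x \<noteq> L j k x" if "x \<in> {-1..r i}" "x \<in> {- r k..r j}"
      using LU[of x] that by simp
    show "L i j x \<noteq> U j k x" if "x \<in> {- r j..r i}" "x \<in> {-1..r j}"
      using UL[of x] that by simp
    show "L i j x \<noteq> L j k x" if "x \<in> {- r j..r i}" "x \<in> {- r k..r j}"
      using LL[of x] that by simp
  qed
qed

lemma spikes_disjoint_imp_consecutive:
  assumes "i < j" "j \<le> N" "k < l" "l \<le> N" "spike i j \<inter> spike k l = {}"
  shows "j = k \<or> l = i"
proof -
  \<comment> \<open>By symmetry the smaller first entry may be \<open>a\<close>; comparing
    \<open>b\<close> with \<open>c\<close> and then with \<open>d\<close> leaves only the listed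
    meeting cases.\<close>
  have *: "b = c \<or> d = a"
    if "a < c" "a < b" "b \<le> N" "c < d" "d \<le> N" "spike a b \<inter> spike c d = {}" for a b c d
    using that spikes_meet_separated[of a b c d] spikes_meet_interleaved[of a c b d]
      spikes_meet_nested[of a c d b] spikes_meet_same_right[of a b c]
    by (metis linorder_neqE_nat)
  have "i \<noteq> k" using assms(5) spikes_meet_same_left by blast
  then show ?thesis
    using *[of i k j l] *[of k i l j] assms by (metis Int_commute linorder_neqE_nat)
qed

section \<open>The family of spikes as a shift graph\<close>

definition spikes :: "(real^2) set set" where
  "spikes = (\<lambda>(i, j). spike i j) ` {(i, j). i < j \<and> j \<le> N}"

lemma spike_in_spikes: "i < j \<Longrightarrow> j \<le> N \<Longrightarrow> spike i j \<in> spikes"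
  by (auto simp: spikes_def)

lemma finite_spikes: "finite spikes"
proof -
  have "{(i, j). i < j \<and> j \<le> N} \<subseteq> {..N} \<times> {..N}" by auto
  then show ?thesis unfolding spikes_def by (meson finite_SigmaI finite_atMost finite_imageI finite_subset)
qed

text \<open>Each adjacency glues the end of one pair to the start of another. Three of them either
  close an increasing cycle or force the two entries of some pair to coincide.\<close>

lemma spikes_triangle_free: "triangle_free spikes (disj_adj spikes)"
  unfolding triangle_free_def
proof (intro notI, elim bexE conjE)
  fix S T W assume "S \<in> spikes" "T \<in> spikes" "W \<in> spikes"
  then obtain a b c d e f where *: "a < b" "b \<le> N" "c < d" "d \<le> N" "e < f" "f \<le> N"
    and STW: "S = spike a b" "T = spike c d" "W = spike e f"
    unfolding spikes_def by blast
  assume "disj_adj spikes S T" "disj_adj spikes T W" "disj_adj spikes S W"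
  then have "b = c \<or> d = a" "d = e \<or> f = c" "b = e \<or> f = a"
    using * unfolding STW disj_adj_def by (simp_all add: spikes_disjoint_imp_consecutive)
  then show False using * by linarith
qed

lemma spikes_chromatic_number: "N < 2 ^ chromatic_number spikes (disj_adj spikes)"
proof -
  obtain c where c: "proper_colouring spikes (disj_adj spikes) c (chromatic_number spikes (disj_adj spikes))"
    using ex_proper_colouring_chromatic_number[OF finite_spikes] by blast
  show ?thesis
  proof (rule shift_colouring_bound[where c = "\<lambda>i j. c (spike i j)"])
    fix i j k assume ijk: "i < j" "j < k" "k \<le> N"
    \<comment> \<open>Disjoint nonempty sets are distinct, as \<open>disj_adj\<close>
      demands.\<close>
    have "spike i j \<noteq> {}" using spikes_meet_same_left by fastforce
    then have "disj_adj spikes (spike i j) (spike j k)"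
      using spikes_disjoint_consecutive[OF ijk] ijk spike_in_spikes by (auto simp: disj_adj_def)
    then show "c (spike i j) \<noteq> c (spike j k)"
      using c by (simp add: proper_colouring_def disj_adj_def)
  qed (use c spike_in_spikes in \<open>auto simp: proper_colouring_def\<close>)
qed

end

lemma ex_scales: "\<exists>h r. scales N h r"
proof -
  \<comment> \<open>One geometric sequence supplies both scales, odd powers for \<open>h\<close> and
    even ones for \<open>r\<close>; the ratio \<open>e\<close> satisfies
    \<open>4 * (N + 1) * e = 1 / 2\<close> and \<open>8 * e \<le> 1\<close>.\<close>
  define e :: real where "e = 1 / (8 * (real N + 1))"
  have e: "0 < e" "e \<le> 1 / 8" "8 * (real N + 1) * e = 1"
    by (auto simp: e_def field_simps)
  have "scales N (\<lambda>j. e ^ (2 * j + 1)) (\<lambda>j. e ^ (2 * j + 2))"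
  proof
    fix i j :: nat
    show "0 < e ^ (2 * j + 2)" using e by simp
    show "e ^ (2 * j + 1) \<le> 1 / 2"
      using e power_le_one[of e "2 * j"] mult_mono[of e "1 / 8" "e ^ (2 * j)" 1] by simp
    have "4 * (real N + 1) * e ^ (2 * j + 2) = (8 * (real N + 1) * e) * e ^ (2 * j + 1) / 2"
      by simp
    then show "4 * (real N + 1) * e ^ (2 * j + 2) \<le> e ^ (2 * j + 1)"
      unfolding e(3) using e(1) by simp
    assume "i < j"
    then have "e ^ (2 * j + 1) \<le> e ^ (2 * i + 3)"
      using e by (intro power_decreasing) auto
    also have "\<dots> = e * e ^ (2 * i + 2)"
      by (simp add: eval_nat_numeral)
    also have "\<dots> \<le> 1 / 8 * e ^ (2 * i + 2)"
      using e by (intro mult_right_mono) auto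
    finally show "8 * e ^ (2 * j + 1) \<le> e ^ (2 * i + 2)" by simp
  qed
  then show ?thesis by blast
qed

theorem theorem1:
  fixes k :: nat
  assumes "k \<ge> 1"
  shows "\<exists>F :: (real^2) set set. finite F \<and> (\<forall>S\<in>F. polygonal_2chain S) \<and>
           triangle_free F (disj_adj F) \<and> chromatic_number F (disj_adj F) \<ge> k"
proof -
  \<comment> \<open>With \<open>N = 2 ^ k\<close> the logarithmic bound gives more than
    \<open>k\<close> colours.\<close>
  obtain h r where "scales (2 ^ k) h r" using ex_scales by blast
  then interpret scales "2 ^ k" h r .
  have "k \<le> chromatic_number spikes (disj_adj spikes)"
    using spikes_chromatic_number by (simp add: less_imp_le)
  moreover have "\<forall>S\<in>spikes. polygonal_2chain S"
    using spike_2chain by (auto simp: spikes_def)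
  ultimately show ?thesis
    using finite_spikes spikes_triangle_free by blast
qed

end
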